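(* Let $k,n,\ell$ be positive integers with $1 \leq \ell \leq \binom{k}{2}$ and let $v=k(k-1)n+2\ell$. Define the two sets $$S= \left\{ \left\lfloor \frac{v}{4} \right\rfloor - h \ : \ h\in\mathbb{Z},\ 0\leq h\leq \ell-1 \right\}$$ and $$T=\left\{h(k-h) \ : \ h\in\mathbb{Z},\ 0\leq h\leq \left\lfloor \frac{k}{2} \right\rfloor \right\}.$$ Then a necessary condition for the existence of an optimal $(v,k,1)$-optical orthogonal code is that at least one element of $S$ is representable as a sum of $n$ (not necessarily distinct) integers of $T$.
   Context: A $(v,k,1)$-optical orthogonal code ($(v,k,1)$-OOC) of size $n$ is a set $\mathcal{C}$ of $n$ $(0,1)$-vectors of length $v$, each of Hamming weight $k$, such that (with subscripts reduced modulo $v$): for every $\mathbf{x}=(x_0,\dots,x_{v-1}) \in \mathcal{C}$ and every integer $0<\tau<v$, $\sum_{i=0}^{v-1} x_i x_{i+\tau} \le 1$; and for all $\mathbf{x}\ne\mathbf{y}$ in $\mathcal{C}$ and every integer $0\le\tau<v$, $\sum_{i=0}^{v-1} x_i y_{i+\tau} \le 1$. The size of a $(v,k,1)$-OOC is always at most $\left\lfloor \frac{v-1}{k(k-1)} \right\rfloor$; it is called optimal if its size equals $\left\lfloor \frac{v-1}{k(k-1)} \right\rfloor$. *)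

theory Defs
  imports Complex_Main
begin

text \<open>A vector \<open>(x\<^sub>0, \<dots>, x\<^sub>v\<^sub>-\<^sub>1)\<close> is a list of length \<open>v\<close>, with entry \<open>x ! i\<close> at position \<open>i\<close>.\<close>

definition hamming_weight :: "nat list \<Rightarrow> nat" where
  "hamming_weight x = card {i. i < length x \<and> x ! i \<noteq> 0}"

definition correlation :: "nat \<Rightarrow> nat list \<Rightarrow> nat list \<Rightarrow> nat \<Rightarrow> nat" where
  "correlation v x y \<tau> = (\<Sum>i<v. x ! i * y ! ((i + \<tau>) mod v))"

text \<open>The property of being a \<open>(v, k, 1)\<close>-optical orthogonal code. Its size is \<open>card C\<close>;
  \<open>C\<close> is always finite, as there are only finitely many 0-1 lists of length \<open>v\<close>.\<close>

definition ooc :: "nat \<Rightarrow> nat \<Rightarrow> nat list set \<Rightarrow> bool" where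
  "ooc v k C \<longleftrightarrow>
     (\<forall>x\<in>C. length x = v \<and> set x \<subseteq> {0, 1} \<and> hamming_weight x = k) \<and>
     (\<forall>x\<in>C. \<forall>\<tau>. 0 < \<tau> \<and> \<tau> < v \<longrightarrow> correlation v x x \<tau> \<le> 1) \<and>
     (\<forall>x\<in>C. \<forall>y\<in>C. x \<noteq> y \<longrightarrow> (\<forall>\<tau><v. correlation v x y \<tau> \<le> 1))"

definition optimal_ooc :: "nat \<Rightarrow> nat \<Rightarrow> nat list set \<Rightarrow> bool" where
  "optimal_ooc v k C \<longleftrightarrow> ooc v k C \<and> card C = (v - 1) div (k * (k - 1))"

end

theory Submission
  imports Defs
begin

text \<open>
  The size of an optimal code is exactly \<open>n\<close>, because \<open>2l - 1 < k(k - 1)\<close>. Read each codeword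
  as the set of positions of its nonzero entries, a \<open>k\<close>-subset of the integers modulo \<open>v\<close>.
  By the correlation conditions no nonzero residue is a difference of two elements of one
  of these sets in more than one way (\<open>ooc_inj_on_difference\<close>), so the code uses
  \<open>k(k - 1)n = v - 2l\<close> distinct nonzero residues as differences.

  As \<open>v\<close> is even, residues modulo \<open>v\<close> have a parity. A codeword with \<open>h\<close> odd and \<open>k - h\<close> even
  positions contributes \<open>2h(k - h)\<close> odd differences (\<open>card_mixed_parity_pairs\<close>), that is,
  twice an element of \<open>T\<close>, since \<open>h\<close> may be exchanged with \<open>k - h\<close>. Let \<open>s\<close> be the sum
  of these elements of \<open>T\<close> over the \<open>n\<close> codewords. There are \<open>v/2\<close> odd residues, whence
  \<open>2s \<le> v/2\<close>, and \<open>v/2 - 1\<close> nonzero even ones, whence \<open>v - 2l - 2s \<le> v/2 - 1\<close>. Together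
  these bounds give \<open>v/2 - 2l + 1 \<le> 2s \<le> v/2\<close>, which says that \<open>s\<close> belongs to \<open>S\<close>.
\<close>

section \<open>Differences modulo \<open>v\<close> and their parity\<close>

text \<open>The positions of the nonzero entries of a vector.\<close>

definition support :: "nat list \<Rightarrow> nat set" where
  "support x = {i. i < length x \<and> x ! i \<noteq> 0}"

text \<open>The residue of \<open>j - i\<close> modulo \<open>v\<close>; the truncated subtraction is harmless for \<open>i \<le> v\<close>.\<close>

definition difference :: "nat \<Rightarrow> nat \<Rightarrow> nat \<Rightarrow> nat" where
  "difference v i j = (j + (v - i)) mod v"

text \<open>The ordered pairs of distinct elements of a set.\<close>

definition off_diagonal :: "nat set \<Rightarrow> (nat \<times> nat) set" where
  "off_diagonal A = {(i, j). i \<in> A \<and> j \<in> A \<and> i \<noteq> j}"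

lemma finite_support [simp]: "finite (support x)"
  by (simp add: support_def)

lemma finite_off_diagonal [simp]:
  assumes "finite A"
  shows "finite (off_diagonal A)"
  by (rule finite_subset[of _ "A \<times> A"]) (auto simp: off_diagonal_def assms)

lemma add_difference_mod:
  assumes "i < v" and "j < v"
  shows "(i + difference v i j) mod v = j"
proof -
  have "(i + difference v i j) mod v = (i + (j + (v - i))) mod v"
    by (simp add: difference_def mod_add_right_eq)
  also have "i + (j + (v - i)) = j + v"
    using assms by simp
  finally show ?thesis
    using assms by simp
qed

lemma difference_bounds:
  assumes "i < v" and "j < v" and "i \<noteq> j"
  shows "0 < difference v i j" and "difference v i j < v"
proof -
  show "0 < difference v i j"
    using add_difference_mod[OF assms(1,2)] assms by (cases "difference v i j") auto
  show "difference v i j < v"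
    using assms by (simp add: difference_def)
qed

lemma even_difference_iff:
  assumes "even v" and "i < v"
  shows "even (difference v i j) \<longleftrightarrow> (even i \<longleftrightarrow> even j)"
proof -
  have "even (difference v i j) \<longleftrightarrow> even (j + (v - i))"
    using assms(1) by (simp add: difference_def dvd_mod_iff)
  then show ?thesis
    using assms by auto
qed

lemma card_off_diagonal:
  assumes "finite A"
  shows "card (off_diagonal A) = card A * (card A - 1)"
proof -
  have "off_diagonal A = (A \<times> A) - (\<lambda>i. (i, i)) ` A"
    by (auto simp: off_diagonal_def)
  moreover have "card ((A \<times> A) - (\<lambda>i. (i, i)) ` A) = card (A \<times> A) - card ((\<lambda>i. (i, i)) ` A)"
    using assms by (intro card_Diff_subset) auto
  moreover have "card ((\<lambda>i. (i, i)) ` A) = card A"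
    by (intro card_image) (auto simp: inj_on_def)
  ultimately show ?thesis
    by (simp add: card_cartesian_product right_diff_distrib')
qed

lemma card_mixed_parity_pairs:
  fixes A :: "nat set"
  assumes "finite A"
  defines "h \<equiv> card {i \<in> A. odd i}"
  shows "card {(i, j) \<in> off_diagonal A. odd i \<noteq> odd j} = 2 * (h * (card A - h))"
proof -
  let ?O = "{i \<in> A. odd i}" and ?E = "{i \<in> A. even i}"
  have "card A = card (?O \<union> ?E)"
    by (rule arg_cong[of _ _ card]) auto
  also have "\<dots> = card ?O + card ?E"
    using assms(1) by (intro card_Un_disjoint) auto
  finally have E: "card ?E = card A - h"
    by (simp add: h_def)
  have "{(i, j) \<in> off_diagonal A. odd i \<noteq> odd j} = ?O \<times> ?E \<union> ?E \<times> ?O"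
    by (auto simp: off_diagonal_def)
  moreover have "card (?O \<times> ?E \<union> ?E \<times> ?O) = card (?O \<times> ?E) + card (?E \<times> ?O)"
    using assms(1) by (intro card_Un_disjoint) auto
  moreover have "card (?O \<times> ?E) = h * (card A - h)" and "card (?E \<times> ?O) = (card A - h) * h"
    by (simp_all only: card_cartesian_product E) (simp_all only: h_def)
  ultimately show ?thesis
    by (simp only: mult.commute[of h] mult_2)
qed

section \<open>Differences occurring in an optical orthogonal code\<close>

lemma correlation_two_coincidences:
  assumes "i < v" and "j < v" and "i \<noteq> j"
    and "x ! i \<noteq> 0" and "y ! ((i + \<tau>) mod v) \<noteq> 0"
    and "x ! j \<noteq> 0" and "y ! ((j + \<tau>) mod v) \<noteq> 0"
  shows "correlation v x y \<tau> \<ge> 2"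
proof -
  let ?f = "\<lambda>i. x ! i * y ! ((i + \<tau>) mod v)"
  have "?f i \<noteq> 0" and "?f j \<noteq> 0"
    using assms by simp_all
  then have "2 \<le> ?f i + ?f j"
    by linarith
  also have "\<dots> = sum ?f {i, j}"
    using assms by simp
  also have "\<dots> \<le> sum ?f {..<v}"
    using assms by (intro sum_mono2) auto
  finally show ?thesis
    by (simp add: correlation_def)
qed

text \<open>
  Equal differences inside one codeword violate the autocorrelation bound at the common
  difference; equal differences of distinct codewords violate the cross-correlation
  bound at the shift that aligns the two pairs.
\<close>

lemma ooc_difference_eqD:
  assumes ooc: "ooc v k C" and x: "x \<in> C" and ij: "(i, j) \<in> off_diagonal (support x)"
    and y: "y \<in> C" and ab: "(a, b) \<in> off_diagonal (support y)"
    and eq: "difference v i j = difference v a b"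
  shows "x = y \<and> i = a \<and> j = b"
proof -
  have len: "length x = v" "length y = v"
    using ooc x y by (auto simp: ooc_def)
  have i: "i < v" "x ! i \<noteq> 0" and j: "j < v" "x ! j \<noteq> 0" and ne: "i \<noteq> j"
    and a: "a < v" "y ! a \<noteq> 0" and b: "b < v" "y ! b \<noteq> 0"
    using ij ab len by (auto simp: off_diagonal_def support_def)
  have j_eq: "(i + difference v i j) mod v = j"
    using i j by (intro add_difference_mod)
  have b_eq: "(a + difference v i j) mod v = b"
    unfolding eq using a b by (intro add_difference_mod)
  have xy: "x = y"
  proof (rule ccontr)
    assume "x \<noteq> y"
    let ?\<tau> = "difference v i a"
    have "(j + ?\<tau>) mod v = (j + (a + (v - i))) mod v"
      by (simp add: difference_def mod_add_right_eq)
    also have "j + (a + (v - i)) = a + (j + (v - i))"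
      by simp
    also have "\<dots> mod v = (a + difference v i j) mod v"
      by (simp add: difference_def mod_add_right_eq)
    also have "\<dots> = b"
      by (rule b_eq)
    finally have "correlation v x y ?\<tau> \<ge> 2"
      using i j a b ne add_difference_mod[OF i(1) a(1)]
      by (intro correlation_two_coincidences[of i v j]) simp_all
    moreover have "?\<tau> < v"
      using i by (simp add: difference_def)
    then have "correlation v x y ?\<tau> \<le> 1"
      using ooc x y \<open>x \<noteq> y\<close> by (auto simp: ooc_def)
    ultimately show False
      by simp
  qed
  have ia: "i = a"
  proof (rule ccontr)
    assume "i \<noteq> a"
    then have "correlation v x x (difference v i j) \<ge> 2"
      using i j a b xy j_eq b_eq by (intro correlation_two_coincidences[of i v a]) simp_all
    moreover have "correlation v x x (difference v i j) \<le> 1"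
      using ooc x difference_bounds[OF i(1) j(1) ne] by (auto simp: ooc_def)
    ultimately show False
      by simp
  qed
  show ?thesis
    using xy ia j_eq b_eq by simp
qed

lemma ooc_inj_on_difference:
  assumes "ooc v k C"
  shows "inj_on (\<lambda>(x, i, j). difference v i j) (SIGMA x:C. off_diagonal (support x))"
  by (rule inj_onI) (auto dest: ooc_difference_eqD[OF assms])

section \<open>Counting odd and even differences\<close>

text \<open>
  Differences in the code are pairwise distinct and nonzero, so at most \<open>m\<close> of them are odd
  and at most \<open>m - 1\<close> are even. Exactly \<open>2 * s\<close> of them are odd, and there are
  \<open>card C * (k * (k - 1))\<close> in all.
\<close>

lemma ooc_parity_bounds:
  assumes ooc: "ooc (2 * m) k C" and fin: "finite C"
  defines "s \<equiv> \<Sum>x\<in>C. card {i \<in> support x. odd i} * (k - card {i \<in> support x. odd i})"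
  shows "2 * s \<le> m" and "card C * (k * (k - 1)) \<le> 2 * s + (m - 1)"
proof -
  let ?v = "2 * m"
  let ?D = "SIGMA x:C. off_diagonal (support x)"
  let ?d = "\<lambda>(x :: nat list, i, j). difference ?v i j"
  let ?Odd = "SIGMA x:C. {(i, j) \<in> off_diagonal (support x). odd i \<noteq> odd j}"
  let ?Even = "SIGMA x:C. {(i, j) \<in> off_diagonal (support x). odd i = odd j}"
  have supp: "support x \<subseteq> {..<?v}" "card (support x) = k" if "x \<in> C" for x
    using ooc that by (auto simp: ooc_def support_def hamming_weight_def)
  have fin_fibre: "finite {(i, j) \<in> off_diagonal (support x). P i j}" for x P
    by (rule finite_subset[of _ "off_diagonal (support x)"]) auto
  have sub: "?Even \<subseteq> ?D" "?Odd \<subseteq> ?D"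
    by auto
  have inj: "inj_on ?d ?D"
    using ooc by (rule ooc_inj_on_difference)
  have "card ?D = (\<Sum>x\<in>C. k * (k - 1))"
    using fin by (simp add: card_SigmaI card_off_diagonal supp)
  then have card_D: "card ?D = card C * (k * (k - 1))"
    by simp
  have "card ?Odd = (\<Sum>x\<in>C. card {(i, j) \<in> off_diagonal (support x). odd i \<noteq> odd j})"
    using fin by (intro card_SigmaI) (auto intro: fin_fibre)
  also have "\<dots> = 2 * s"
    unfolding s_def sum_distrib_left
    by (intro sum.cong) (simp_all only: card_mixed_parity_pairs finite_support supp)
  finally have card_Odd: "card ?Odd = 2 * s" .
  have "card ?D = card (?Odd \<union> ?Even)"
    by (rule arg_cong[of _ _ card]) auto
  also have "\<dots> \<le> card ?Odd + card ?Even"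
    by (rule card_Un_le)
  finally have le: "card C * (k * (k - 1)) \<le> 2 * s + card ?Even"
    by (simp only: card_D card_Odd)

  have "card ?Odd = card (?d ` ?Odd)"
    by (rule card_image[symmetric], rule inj_on_subset[OF inj sub(2)])
  moreover have "?d ` ?Odd \<subseteq> (\<lambda>r. 2 * r + 1) ` {..<m}"
  proof clarify
    fix x i j
    assume x: "x \<in> C" and ij: "(i, j) \<in> off_diagonal (support x)" and par: "odd i \<noteq> odd j"
    have lt: "i < ?v" "j < ?v" "i \<noteq> j"
      using supp(1)[OF x] ij by (auto simp: off_diagonal_def)
    have "odd (difference ?v i j)"
      using even_difference_iff[of ?v i j] lt par by auto
    then obtain r where r: "difference ?v i j = 2 * r + 1"
      by (rule oddE)
    moreover have "r < m"
      using difference_bounds(2)[OF lt] r by simp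
    ultimately show "difference ?v i j \<in> (\<lambda>r. 2 * r + 1) ` {..<m}"
      by auto
  qed
  then have "card (?d ` ?Odd) \<le> card {..<m}"
    by (intro surj_card_le) auto
  ultimately show "2 * s \<le> m"
    using card_Odd by simp

  have "card ?Even = card (?d ` ?Even)"
    by (rule card_image[symmetric], rule inj_on_subset[OF inj sub(1)])
  moreover have "?d ` ?Even \<subseteq> (\<lambda>r. 2 * r) ` {1..<m}"
  proof clarify
    fix x i j
    assume x: "x \<in> C" and ij: "(i, j) \<in> off_diagonal (support x)" and par: "odd i = odd j"
    have lt: "i < ?v" "j < ?v" "i \<noteq> j"
      using supp(1)[OF x] ij by (auto simp: off_diagonal_def)
    have "even (difference ?v i j)"
      using even_difference_iff[of ?v i j] lt par by auto
    then obtain r where r: "difference ?v i j = 2 * r"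
      by (rule evenE)
    moreover have "1 \<le> r" and "r < m"
      using difference_bounds[OF lt] r by simp_all
    ultimately show "difference ?v i j \<in> (\<lambda>r. 2 * r) ` {1..<m}"
      by auto
  qed
  then have "card (?d ` ?Even) \<le> card {1..<m}"
    by (intro surj_card_le) auto
  ultimately show "card C * (k * (k - 1)) \<le> 2 * s + (m - 1)"
    using le by simp
qed

section \<open>The representability condition\<close>

theorem theorem4p3:
  fixes k n l v :: nat and S T :: "int set"
  assumes "k > 0" and "n > 0" and "1 \<le> l" and "l \<le> k choose 2"
    and "v = k * (k - 1) * n + 2 * l"
    and "S = {int v div 4 - h | h :: int. 0 \<le> h \<and> h \<le> int l - 1}"
    and "T = {h * (int k - h) | h :: int. 0 \<le> h \<and> h \<le> int k div 2}"
    and "\<exists>C. optimal_ooc v k C"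
  shows "\<exists>s\<in>S. \<exists>t :: nat \<Rightarrow> int. (\<forall>i<n. t i \<in> T) \<and> s = (\<Sum>i<n. t i)"
proof -
  obtain C where C: "ooc v k C" and card_C: "card C = (v - 1) div (k * (k - 1))"
    using assms(8) by (auto simp: optimal_ooc_def)
  have "even (k * (k - 1))"
    by (cases k) auto
  then have "2 * l \<le> k * (k - 1)"
    using assms(4) unfolding choose_two by linarith
  \<comment> \<open>The remainder \<open>2l - 1\<close> is less than \<open>k(k - 1)\<close>, so the quotient is \<open>n\<close>.\<close>
  moreover have "v - 1 = n * (k * (k - 1)) + (2 * l - 1)"
    using assms(3) unfolding assms(5) by (simp add: ac_simps)
  ultimately have card_n: "card C = n"
    unfolding card_C using assms(3) by (intro div_nat_eqI) (simp_all add: mult.commute)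
  then have fin: "finite C"
    using assms(2) by (intro card_ge_0_finite) simp
  have "even v"
    unfolding assms(5) using \<open>even (k * (k - 1))\<close> by simp
  then obtain m where m: "v = 2 * m"
    by (rule evenE)

  define h where "h x = card {i \<in> support x. odd i}" for x
  have h_le: "h x \<le> k" if "x \<in> C" for x
  proof -
    have "h x \<le> card (support x)"
      unfolding h_def by (intro card_mono) auto
    also have "\<dots> = k"
      using C that by (auto simp: ooc_def support_def hamming_weight_def)
    finally show ?thesis .
  qed
  define s where "s = (\<Sum>x\<in>C. h x * (k - h x))"
  have upper: "2 * s \<le> m" and lower: "n * (k * (k - 1)) \<le> 2 * s + (m - 1)"
    using ooc_parity_bounds[OF C[unfolded m] fin] by (simp_all add: s_def h_def card_n)

  have "int s \<in> S"
  proof -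
    have "2 * m \<le> 2 * s + (m - 1) + 2 * l"
      using lower assms(5) m by (simp add: ac_simps)
    then have "int v div 4 - int s \<le> int l - 1" and "0 \<le> int v div 4 - int s"
      using upper assms(3) m by presburger+
    then show ?thesis
      unfolding assms(6) by (intro CollectI exI[of _ "int v div 4 - int s"]) simp
  qed
  moreover have "\<exists>t. (\<forall>i<n. t i \<in> T) \<and> int s = (\<Sum>i<n. t i)"
  proof -
    obtain g where g: "bij_betw g {..<n} C"
      using ex_bij_betw_nat_finite[OF fin] card_n by (auto simp: atLeast0LessThan)
    let ?t = "\<lambda>i. int (h (g i) * (k - h (g i)))"
    have "?t i \<in> T" if "i < n" for i
    proof -
      have le: "h (g i) \<le> k"
        using g that by (intro h_le) (auto simp: bij_betw_def)
      \<comment> \<open>\<open>T\<close> only uses \<open>h \<le> k div 2\<close>; the product is symmetric under \<open>h \<mapsto> k - h\<close>.\<close>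
      let ?h = "min (int (h (g i))) (int k - int (h (g i)))"
      have "?t i = ?h * (int k - ?h)"
        using le by (auto simp: min_def of_nat_diff)
      moreover have "0 \<le> ?h" and "?h \<le> int k div 2"
        using le by linarith+
      ultimately show ?thesis
        unfolding assms(7) by blast
    qed
    moreover have "int s = (\<Sum>i<n. ?t i)"
      unfolding s_def of_nat_sum by (rule sum.reindex_bij_betw[OF g, symmetric])
    ultimately show ?thesis
      by (intro exI[of _ ?t]) simp
  qed
  ultimately show ?thesis
    by (rule bexI[rotated])
qed

end
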